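(* For any three elements $x,y,z\in\mathcal R$, we have $(x\otimes y)\otimes z\sim x\otimes(y\otimes z)$.
   Context: $\mathbb N=\{1,2,3,\dots\}$ and $\mathcal Z_{10}=\{0,1,\dots,9\}$. $\mathcal R$ is the set of all formal decimals $x=x_0.x_1x_2x_3\cdots$ with $x_0\in\mathbb Z$ and $x_k\in\mathcal Z_{10}$ for $k\in\mathbb N$; two elements are equal iff all their digits agree. For $k\in\mathbb N$, $[x]_k=\sum_{i=0}^k x_i10^{-i}\in\mathbb Q$. Order on $\mathcal R$: $x\preceq y$ iff $[x]_k\le [y]_k$ for all $k\in\mathbb N$. Every nonempty bounded above (below) subset of $(\mathcal R,\preceq)$ has a supremum (infimum). $x\sim y$ ("no gap") means that there is no $z\in\mathcal R\setminus\{x,y\}$ lying strictly between $x$ and $y$ with respect to $\preceq$; $\sim$ is an equivalence relation. $\mathbb Q$ is regarded as a subset of $\mathcal R$ via long division: $\alpha=q/p$ ($p\in\mathbb N$, $q\in\mathbb Z$) is identified with $\alpha_0.\alpha_1\alpha_2\cdots$, where $\alpha_0=\lfloor q/p\rfloor$, $\beta_0=q-\alpha_0p$, $\alpha_{k+1}=\lfloor 10\beta_k/p\rfloor$, $\beta_{k+1}=10\beta_k-\alpha_{k+1}p$. For a bounded sequence $\{x^{(n)}\}_{n\in\mathbb N}$ in $\mathcal R$: $\overline{\mathrm{LIMIT}}(\{x^{(n)}\})=\inf\{\sup\{x^{(k)}: k\ge n\}: n\in\mathbb N\}$ and $\underline{\mathrm{LIMIT}}(\{x^{(n)}\})=\sup\{\inf\{x^{(k)}: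 k\ge n\}: n\in\mathbb N\}$; if they are equal, the common value is denoted $\mathrm{LIMIT}(\{x^{(n)}\})$. It exists for bounded monotone sequences. Additive inverse map: $\Psi(x_0.x_1x_2x_3\cdots)=(-1-x_0).(9-x_1)(9-x_2)(9-x_3)\cdots$; $\Psi^{(k)}$ is the $k$-fold composite of $\Psi$ ($\Psi^{(0)}=\mathrm{id}$). Absolute value: $\|x\|=\max\{x,\Psi(x)\}$ (with respect to $\preceq$). Sign: $\mathrm{sign}(x)=0$ if $x\succeq 0.000000\cdots$ and $\mathrm{sign}(x)=1$ if $x\preceq(-1).999999\cdots$. Multiplication: $x\otimes y=\Psi^{(\mathrm{sign}(x)+\mathrm{sign}(y))}\big(\mathrm{LIMIT}(\{[\|x\|]_k\cdot[\|y\|]_k\}_{k\in\mathbb N})\big)$, the products $[\|x\|]_k\cdot[\|y\|]_k$ being taken in $\mathbb Q$. *)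

theory Defs
  imports Complex_Main
begin

section \<open>Formal decimals\<close>

text \<open>Digit 0 is the integer part, an arbitrary integer. Decimals ending in repeated nines are not
  identified with the corresponding terminating ones.\<close>

typedef decimal = "{x :: nat \<Rightarrow> int. \<forall>k\<ge>1. x k \<in> {0..9}}"
  morphisms digit Decimal
  by (rule exI[of _ "\<lambda>_. 0"]) simp

setup_lifting type_definition_decimal

lemma digit_range: "k \<ge> 1 \<Longrightarrow> 0 \<le> digit x k \<and> digit x k \<le> 9"
  using digit[of x] by auto

lemma decimal_eqI: "(\<And>k. digit x k = digit y k) \<Longrightarrow> x = y"
  by (metis digit_inject ext)

definition trunc :: "nat \<Rightarrow> decimal \<Rightarrow> rat" where
  "trunc k x = (\<Sum>i=0..k. of_int (digit x i) / 10 ^ i)"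


section \<open>Order and completeness\<close>

instantiation decimal :: ord
begin

definition less_eq_decimal :: "decimal \<Rightarrow> decimal \<Rightarrow> bool" where
  "x \<le> y \<longleftrightarrow> (\<forall>k\<ge>1. trunc k x \<le> trunc k y)"

definition less_decimal :: "decimal \<Rightarrow> decimal \<Rightarrow> bool" where
  "x < y \<longleftrightarrow> x \<le> y \<and> x \<noteq> (y::decimal)"

instance ..

end

primrec scaled_trunc :: "decimal \<Rightarrow> nat \<Rightarrow> int" where
  "scaled_trunc x 0 = digit x 0"
| "scaled_trunc x (Suc k) = 10 * scaled_trunc x k + digit x (Suc k)"

lemma trunc_eq_scaled: "trunc k x = of_int (scaled_trunc x k) / 10 ^ k"
  by (induction k) (simp_all add: trunc_def field_simps)

lemma trunc_le_iff: "trunc k x \<le> trunc k y \<longleftrightarrow> scaled_trunc x k \<le> scaled_trunc y k"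
  by (simp add: trunc_eq_scaled divide_le_cancel)

lemma scaled_trunc_div: "scaled_trunc x (Suc k) div 10 = scaled_trunc x k"
  using digit_range[of "Suc k" x] by simp

lemma decimal_le_iff: "x \<le> y \<longleftrightarrow> (\<forall>k. scaled_trunc x k \<le> scaled_trunc y k)"
proof
  assume "x \<le> y"
  then have *: "scaled_trunc x k \<le> scaled_trunc y k" if "k \<ge> 1" for k
    using that by (simp add: less_eq_decimal_def trunc_le_iff)
  have "scaled_trunc x 0 \<le> scaled_trunc y 0"
    using zdiv_mono1[OF *[of "Suc 0"], of 10] unfolding scaled_trunc_div by simp
  with * show "\<forall>k. scaled_trunc x k \<le> scaled_trunc y k"
    by (metis not_less_eq_eq le_zero_eq One_nat_def)
qed (simp add: less_eq_decimal_def trunc_le_iff)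

lemma scaled_trunc_inject:
  assumes "\<And>k. scaled_trunc x k = scaled_trunc y k"
  shows "x = y"
proof (rule decimal_eqI)
  fix k show "digit x k = digit y k"
  proof (cases k)
    case 0
    then show ?thesis using assms[of 0] by simp
  next
    case (Suc j)
    then show ?thesis using assms[of j] assms[of "Suc j"] by simp
  qed
qed

lemma scaled_trunc_less_later:
  assumes "scaled_trunc x k < scaled_trunc y k" "k \<le> j"
  shows "scaled_trunc x j < scaled_trunc y j"
  using assms(2,1)
proof (induction j rule: dec_induct)
  case (step n)
  then show ?case
    using digit_range[of "Suc n" x] digit_range[of "Suc n" y] by simp
qed

lemma scaled_trunc_le_earlier:
  assumes "scaled_trunc x k \<le> scaled_trunc y k" "j \<le> k"
  shows "scaled_trunc x j \<le> scaled_trunc y j"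
  using scaled_trunc_less_later[of y j x k] assms by linarith

instance decimal :: linorder
proof
  fix x y z :: decimal
  show antisym: "x \<le> y \<Longrightarrow> y \<le> x \<Longrightarrow> x = y"
    by (rule scaled_trunc_inject) (simp add: decimal_le_iff order_antisym)
  show "x \<le> x"
    by (simp add: decimal_le_iff)
  show "x \<le> y \<Longrightarrow> y \<le> z \<Longrightarrow> x \<le> z"
    unfolding decimal_le_iff by (meson order_trans)
  show "(x < y) = (x \<le> y \<and> \<not> y \<le> x)"
    using antisym \<open>x \<le> x\<close> unfolding less_decimal_def by blast
  show "x \<le> y \<or> y \<le> x"
  proof (rule ccontr)
    assume "\<not> (x \<le> y \<or> y \<le> x)"
    then obtain i j where
      "scaled_trunc y i < scaled_trunc x i" "scaled_trunc x j < scaled_trunc y j"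
      unfolding decimal_le_iff by (meson not_le)
    then show False
      by (meson scaled_trunc_less_later nat_le_linear less_asym)
  qed
qed

lemma decimal_from_scaled:
  assumes "\<And>k. N (Suc k) div 10 = (N k :: int)"
  obtains s where "\<And>k. scaled_trunc s k = N k"
proof -
  define d where "d = (\<lambda>k. if k = 0 then N 0 else N k mod 10)"
  have "\<forall>k\<ge>1. d k \<in> {0..9}"
  proof (intro allI impI)
    fix k :: nat assume "k \<ge> 1"
    have "N k mod 10 \<ge> 0" "N k mod 10 < 10" by simp_all
    with \<open>k \<ge> 1\<close> show "d k \<in> {0..9}" by (simp add: d_def)
  qed
  then have d: "digit (Decimal d) = d"
    by (simp add: Decimal_inverse)
  have "scaled_trunc (Decimal d) k = N k" for k
  proof (induction k)
    case 0
    have "d 0 = N 0" by (simp add: d_def)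
    then show ?case by (simp add: d)
  next
    case (Suc k)
    have "d (Suc k) = N (Suc k) mod 10" by (simp add: d_def)
    moreover have "10 * N k + N (Suc k) mod 10 = N (Suc k)"
      using assms[of k] by (metis mult_div_mod_eq)
    ultimately show ?case using Suc by (simp add: d)
  qed
  then show thesis by (rule that)
qed

lemma int_set_has_max:
  fixes A :: "int set"
  assumes "A \<noteq> {}" "\<And>a. a \<in> A \<Longrightarrow> a \<le> u"
  obtains m where "m \<in> A" "\<And>a. a \<in> A \<Longrightarrow> a \<le> m"
proof -
  from assms(1) obtain a0 where "a0 \<in> A" by blast
  define P where "P = (\<lambda>n. u - int n \<in> A)"
  have "P (nat (u - a0))"
    using assms(2)[OF \<open>a0 \<in> A\<close>] \<open>a0 \<in> A\<close> by (simp add: P_def)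
  then have "P (LEAST n. P n)" by (rule LeastI)
  moreover have "a \<le> u - int (LEAST n. P n)" if "a \<in> A" for a
  proof -
    have "P (nat (u - a))"
      using assms(2)[OF that] that by (simp add: P_def)
    then have "(LEAST n. P n) \<le> nat (u - a)" by (rule Least_le)
    then show ?thesis using assms(2)[OF that] by linarith
  qed
  ultimately show thesis using that unfolding P_def by blast
qed

lemma decimal_has_lub:
  fixes A :: "decimal set"
  assumes ne: "A \<noteq> {}" and ub: "\<And>a. a \<in> A \<Longrightarrow> a \<le> u"
  obtains s where "\<And>a. a \<in> A \<Longrightarrow> a \<le> s" "\<And>v. (\<And>a. a \<in> A \<Longrightarrow> a \<le> v) \<Longrightarrow> s \<le> v"
proof -
  have "\<exists>a\<in>A. \<forall>b\<in>A. scaled_trunc b k \<le> scaled_trunc a k" for k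
  proof -
    obtain m where "m \<in> (\<lambda>a. scaled_trunc a k) ` A"
      "\<And>n. n \<in> (\<lambda>a. scaled_trunc a k) ` A \<Longrightarrow> n \<le> m"
      by (rule int_set_has_max[of "(\<lambda>a. scaled_trunc a k) ` A" "scaled_trunc u k"])
        (use ne ub in \<open>auto simp: decimal_le_iff\<close>)
    then show ?thesis by blast
  qed
  then obtain f where f: "\<And>k. f k \<in> A"
    "\<And>k b. b \<in> A \<Longrightarrow> scaled_trunc b k \<le> scaled_trunc (f k) k"
    by metis
  have "scaled_trunc (f (Suc k)) (Suc k) div 10 = scaled_trunc (f k) k" for k
  proof -
    have "scaled_trunc (f k) k \<le> scaled_trunc (f (Suc k)) k"
      by (rule scaled_trunc_le_earlier[of _ "Suc k"]) (simp_all add: f del: scaled_trunc.simps)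
    moreover have "scaled_trunc (f (Suc k)) k \<le> scaled_trunc (f k) k"
      by (simp add: f)
    ultimately show ?thesis unfolding scaled_trunc_div by simp
  qed
  then obtain s where s: "\<And>k. scaled_trunc s k = scaled_trunc (f k) k"
    by (rule decimal_from_scaled[where N = "\<lambda>k. scaled_trunc (f k) k"]) blast
  show thesis
  proof
    show "a \<le> s" if "a \<in> A" for a
      using that by (simp add: decimal_le_iff s f)
    show "s \<le> v" if "\<And>a. a \<in> A \<Longrightarrow> a \<le> v" for v
      using that f(1) unfolding decimal_le_iff s by blast
  qed
qed

instantiation decimal :: conditionally_complete_linorder
begin

definition inf_decimal :: "decimal \<Rightarrow> decimal \<Rightarrow> decimal" where
  "inf_decimal = min"

definition sup_decimal :: "decimal \<Rightarrow> decimal \<Rightarrow> decimal" where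
  "sup_decimal = max"

definition Sup_decimal :: "decimal set \<Rightarrow> decimal" where
  "Sup (A :: decimal set) = (LEAST s. \<forall>a\<in>A. a \<le> s)"

definition Inf_decimal :: "decimal set \<Rightarrow> decimal" where
  "Inf (A :: decimal set) = (GREATEST s. \<forall>a\<in>A. s \<le> a)"

instance
proof
  have lub: "(\<forall>a\<in>A. a \<le> Sup A) \<and> (\<forall>v. (\<forall>a\<in>A. a \<le> v) \<longrightarrow> Sup A \<le> v)"
    if ne: "A \<noteq> {}" and ub: "\<forall>a\<in>A. a \<le> u" for A :: "decimal set" and u
  proof -
    obtain s where s: "\<And>a. a \<in> A \<Longrightarrow> a \<le> s" "\<And>v. (\<And>a. a \<in> A \<Longrightarrow> a \<le> v) \<Longrightarrow> s \<le> v"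
      using decimal_has_lub[OF ne, of u] ub by blast
    have "Sup A = s"
      unfolding Sup_decimal_def by (rule Least_equality) (use s in auto)
    with s show ?thesis by blast
  qed
  have glb: "(\<forall>a\<in>A. Inf A \<le> a) \<and> (\<forall>v. (\<forall>a\<in>A. v \<le> a) \<longrightarrow> v \<le> Inf A)"
    if ne: "A \<noteq> {}" and lb: "\<forall>a\<in>A. l \<le> a" for A :: "decimal set" and l
  proof -
    from ne obtain b where "b \<in> A" by blast
    have "(\<forall>v\<in>{v. \<forall>a\<in>A. v \<le> a}. v \<le> Sup {v. \<forall>a\<in>A. v \<le> a}) \<and>
        (\<forall>w. (\<forall>v\<in>{v. \<forall>a\<in>A. v \<le> a}. v \<le> w) \<longrightarrow> Sup {v. \<forall>a\<in>A. v \<le> a} \<le> w)"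
      by (rule lub[of _ b]) (use lb \<open>b \<in> A\<close> in auto)
    then have s: "\<forall>a\<in>A. Sup {v. \<forall>a\<in>A. v \<le> a} \<le> a"
      "\<forall>v. (\<forall>a\<in>A. v \<le> a) \<longrightarrow> v \<le> Sup {v. \<forall>a\<in>A. v \<le> a}"
      by blast+
    have "Inf A = Sup {v. \<forall>a\<in>A. v \<le> a}"
      unfolding Inf_decimal_def by (rule Greatest_equality) (use s in auto)
    with s show ?thesis by simp
  qed
  fix x y z :: decimal and X :: "decimal set"
  show "inf x y \<le> x" "inf x y \<le> y" "x \<le> y \<Longrightarrow> x \<le> z \<Longrightarrow> x \<le> inf y z"
    by (simp_all add: inf_decimal_def)
  show "x \<le> sup x y" "y \<le> sup x y" "y \<le> x \<Longrightarrow> z \<le> x \<Longrightarrow> sup y z \<le> x"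
    by (simp_all add: sup_decimal_def)
  show "x \<in> X \<Longrightarrow> bdd_below X \<Longrightarrow> Inf X \<le> x"
    using glb[of X] unfolding bdd_below_def by blast
  show "X \<noteq> {} \<Longrightarrow> (\<And>x. x \<in> X \<Longrightarrow> z \<le> x) \<Longrightarrow> z \<le> Inf X"
    using glb[of X] by blast
  show "x \<in> X \<Longrightarrow> bdd_above X \<Longrightarrow> x \<le> Sup X"
    using lub[of X] unfolding bdd_above_def by blast
  show "X \<noteq> {} \<Longrightarrow> (\<And>x. x \<in> X \<Longrightarrow> x \<le> z) \<Longrightarrow> Sup X \<le> z"
    using lub[of X] by blast
qed

end

definition no_gap :: "decimal \<Rightarrow> decimal \<Rightarrow> bool"  (infix "\<sim>" 50) where
  "x \<sim> y \<longleftrightarrow> \<not> (\<exists>z. z \<notin> {x, y} \<and> (x < z \<and> z < y \<or> y < z \<and> z < x))"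


section \<open>Rational numbers as decimals\<close>

text \<open>The pair at index \<^term>\<open>k\<close> consists of the quotient digit and the remainder after
  \<^term>\<open>k\<close> steps of dividing \<^term>\<open>q\<close> by \<^term>\<open>p\<close>. On integers, \<^term>\<open>q div p\<close> is the floor of
  the quotient.\<close>

primrec long_division :: "int \<Rightarrow> int \<Rightarrow> nat \<Rightarrow> int \<times> int" where
  "long_division q p 0 = (q div p, q - (q div p) * p)"
| "long_division q p (Suc k) =
    (let \<beta> = snd (long_division q p k); \<alpha> = (10 * \<beta>) div p in (\<alpha>, 10 * \<beta> - \<alpha> * p))"

lemma long_division_remainder:
  "p > 0 \<Longrightarrow> 0 \<le> snd (long_division q p k) \<and> snd (long_division q p k) < p"
  by (cases k) (simp_all add: Let_def minus_div_mult_eq_mod)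

lemma long_division_digit_range:
  assumes "p > 0" "k \<ge> 1"
  shows "fst (long_division q p k) \<in> {0..9}"
proof -
  obtain j where k: "k = Suc j" using assms(2) by (cases k) auto
  define b where "b = snd (long_division q p j)"
  have b: "0 \<le> b" "b < p"
    using long_division_remainder[OF assms(1), of q j] by (simp_all add: b_def)
  have "0 \<le> 10 * b div p"
    using b assms(1) by (simp add: pos_imp_zdiv_nonneg_iff)
  moreover have "10 * b div p < 10"
  proof -
    have "10 * b div p * p \<le> 10 * b"
      using minus_mod_eq_div_mult[of "10 * b" p] pos_mod_sign[OF assms(1), of "10 * b"] by linarith
    also have "\<dots> < 10 * p" using b by simp
    finally show ?thesis using assms(1) by (simp add: mult_less_cancel_right)
  qed
  ultimately show ?thesis by (simp add: k b_def Let_def)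
qed

lift_definition decimal_of_rat :: "rat \<Rightarrow> decimal" is
  "\<lambda>r k. fst (long_division (fst (quotient_of r)) (snd (quotient_of r)) k)"
  using long_division_digit_range quotient_of_denom_pos' by blast

lemma long_division_scale:
  assumes "c > 0"
  shows "long_division (c * q) (c * p) k =
    (fst (long_division q p k), c * snd (long_division q p k))"
proof (induction k)
  case 0
  then show ?case using assms by (simp add: algebra_simps)
next
  case (Suc k)
  have "10 * (c * b) div (c * p) = 10 * b div p" for b
    using assms div_mult_mult1[of c "10 * b" p] by (simp add: mult.left_commute)
  with Suc assms show ?case by (simp add: Let_def algebra_simps)
qed

text \<open>The embedding does not depend on the fraction chosen to represent the rational number.\<close>

lemma digit_decimal_of_rat:
  assumes "p > 0"
  shows "digit (decimal_of_rat (of_int q / of_int p)) k = fst (long_division q p k)"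
proof -
  obtain a b where ab: "quotient_of (of_int q / of_int p) = (a, b)" by fastforce
  have "b > 0" and "coprime a b"
    using ab by (auto intro: quotient_of_denom_pos quotient_of_coprime)
  have "(of_int q / of_int p :: rat) = of_int a / of_int b"
    by (rule quotient_of_div[OF ab])
  then have "(of_int (q * b) :: rat) = of_int (a * p)"
    using assms \<open>b > 0\<close> by (simp add: field_simps)
  then have eq: "q * b = a * p" by (simp only: of_int_eq_iff)
  then have "b dvd p"
    using \<open>coprime a b\<close> by (metis coprime_commute coprime_dvd_mult_right_iff dvd_triv_right)
  then obtain c where p: "p = c * b" by (metis dvd_def mult.commute)
  then have "c > 0" using assms \<open>b > 0\<close> by (simp add: zero_less_mult_iff)
  moreover have "q = c * a" using eq p \<open>b > 0\<close> by simp
  ultimately have "fst (long_division q p k) = fst (long_division a b k)"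
    using p long_division_scale[of c a b k] by simp
  then show ?thesis by (simp add: decimal_of_rat.rep_eq ab)
qed


section \<open>Limits of bounded sequences\<close>

text \<open>Sequences are indexed from 1; the value at index 0 is ignored. The notions below are meant
  for bounded sequences, and \<open>LIMIT\<close> for those whose upper and lower limits agree.\<close>

definition upper_LIMIT :: "(nat \<Rightarrow> decimal) \<Rightarrow> decimal" where
  "upper_LIMIT X = Inf {Sup {X k | k. k \<ge> n} | n. n \<ge> 1}"

definition lower_LIMIT :: "(nat \<Rightarrow> decimal) \<Rightarrow> decimal" where
  "lower_LIMIT X = Sup {Inf {X k | k. k \<ge> n} | n. n \<ge> 1}"

definition LIMIT :: "(nat \<Rightarrow> decimal) \<Rightarrow> decimal" where
  "LIMIT X = (THE l. upper_LIMIT X = l \<and> lower_LIMIT X = l)"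


section \<open>Additive inverse, absolute value, sign and multiplication\<close>

lift_definition Psi :: "decimal \<Rightarrow> decimal" is
  "\<lambda>x k. if k = 0 then - 1 - x 0 else 9 - x k"
  by auto

definition absval :: "decimal \<Rightarrow> decimal" where
  "absval x = max x (Psi x)"

lift_definition zero_decimal :: decimal is "\<lambda>_. 0"
  by simp

definition sgn_bit :: "decimal \<Rightarrow> nat" where
  "sgn_bit x = (if x \<ge> zero_decimal then 0 else 1)"

text \<open>The second case is that of the decimals up to the one with integer part \<open>-1\<close> and all other
  digits 9, which is \<open>Psi zero_decimal\<close>.\<close>

lemma digit_Psi_zero: "digit (Psi zero_decimal) k = (if k = 0 then - 1 else 9)"
  by (simp add: Psi.rep_eq zero_decimal.rep_eq)

lemma not_ge_zero_iff: "\<not> x \<ge> zero_decimal \<longleftrightarrow> x \<le> Psi zero_decimal"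
proof -
  have z: "scaled_trunc zero_decimal k = 0" for k
    by (induction k) (simp_all add: zero_decimal.rep_eq)
  have m: "scaled_trunc (Psi zero_decimal) k = - 1" for k
    by (induction k) (simp_all add: digit_Psi_zero)
  show ?thesis
  proof
    assume "\<not> x \<ge> zero_decimal"
    then obtain k where k: "scaled_trunc x k < scaled_trunc zero_decimal k"
      unfolding decimal_le_iff by (meson not_le)
    have "scaled_trunc x j \<le> - 1" for j
    proof (cases "k \<le> j")
      case True
      show ?thesis using scaled_trunc_less_later[OF k True] by (simp add: z)
    next
      case False
      then show ?thesis
        using scaled_trunc_le_earlier[of x k "Psi zero_decimal" j] k by (simp add: z m)
    qed
    then show "x \<le> Psi zero_decimal" by (simp add: decimal_le_iff m)
  next
    assume "x \<le> Psi zero_decimal"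
    then have "scaled_trunc x 0 < scaled_trunc zero_decimal 0"
      unfolding decimal_le_iff z m by (metis less_minus_one_simps(1) order_le_less_trans)
    then show "\<not> x \<ge> zero_decimal" unfolding decimal_le_iff by (meson not_le)
  qed
qed

definition dec_mult :: "decimal \<Rightarrow> decimal \<Rightarrow> decimal"  (infixl "\<otimes>" 70) where
  "x \<otimes> y = (Psi ^^ (sgn_bit x + sgn_bit y))
    (LIMIT (\<lambda>k. decimal_of_rat (trunc k (absval x) * trunc k (absval y))))"

end

theory Submission
  imports Defs
begin

text \<open>Every decimal \<open>x\<close> represents a real number, the limit of its truncations. The set of decimals
  with a given value has at most two elements, and these have no gap between them; so it suffices
  that \<open>\<otimes>\<close> is carried to multiplication of real numbers.\<close>

definition decimal_value :: "decimal \<Rightarrow> real" where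
  "decimal_value x = (SUP k. of_int (scaled_trunc x k) / 10 ^ k)"

lemma incseq_scaled_trunc: "incseq (\<lambda>k. of_int (scaled_trunc x k) / 10 ^ k :: real)"
proof (rule incseq_SucI)
  fix k
  show "of_int (scaled_trunc x k) / 10 ^ k \<le> (of_int (scaled_trunc x (Suc k)) / 10 ^ Suc k :: real)"
    using digit_range[of "Suc k" x] by (simp add: field_simps)
qed

lemma decseq_Suc_scaled_trunc: "decseq (\<lambda>k. (of_int (scaled_trunc x k) + 1) / 10 ^ k :: real)"
proof (rule decseq_SucI)
  fix k
  have "(of_int (digit x (Suc k)) :: real) \<le> 9"
    using digit_range[of "Suc k" x] by simp
  then show "(of_int (scaled_trunc x (Suc k)) + 1) / 10 ^ Suc k
      \<le> ((of_int (scaled_trunc x k) + 1) / 10 ^ k :: real)"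
    by (simp add: field_simps)
qed

text \<open>The intervals from the \<open>k\<close>-th truncation to the same plus
  \<open>1 / 10 ^ k\<close> are nested, so every left endpoint lies below every right endpoint. Both
  are compared at index \<open>max j k\<close>.\<close>

lemma lower_trunc_le_upper_trunc:
  "of_int (scaled_trunc x j) / 10 ^ j \<le> ((of_int (scaled_trunc x k) + 1) / 10 ^ k :: real)"
proof -
  define m where "m = max j k"
  have "of_int (scaled_trunc x j) / 10 ^ j \<le> (of_int (scaled_trunc x m) / 10 ^ m :: real)"
    using incseq_scaled_trunc[of x] by (simp add: incseq_def m_def)
  also have "\<dots> \<le> (of_int (scaled_trunc x m) + 1) / 10 ^ m"
    by (simp add: divide_right_mono)
  also have "\<dots> \<le> (of_int (scaled_trunc x k) + 1) / 10 ^ k"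
    using decseq_Suc_scaled_trunc[of x] by (simp add: decseq_def m_def)
  finally show ?thesis .
qed

lemma bdd_above_scaled_trunc: "bdd_above (range (\<lambda>k. of_int (scaled_trunc x k) / 10 ^ k :: real))"
  using lower_trunc_le_upper_trunc[of x _ 0] by (intro bdd_aboveI) blast

lemma scaled_trunc_le_value: "of_int (scaled_trunc x k) \<le> decimal_value x * 10 ^ k"
proof -
  have "of_int (scaled_trunc x k) / 10 ^ k \<le> decimal_value x"
    unfolding decimal_value_def by (rule cSUP_upper[OF _ bdd_above_scaled_trunc]) simp
  then show ?thesis by (simp add: field_simps)
qed

text \<open>The bound cannot be strict: equality holds when all digits after position
  \<open>k\<close> are 9.\<close>

lemma value_le_scaled_trunc: "decimal_value x * 10 ^ k \<le> of_int (scaled_trunc x k) + 1"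
proof -
  have "decimal_value x \<le> (of_int (scaled_trunc x k) + 1) / 10 ^ k"
    unfolding decimal_value_def by (rule cSUP_least) (simp_all add: lower_trunc_le_upper_trunc)
  then show ?thesis by (simp add: field_simps)
qed

lemma scaled_trunc_tendsto_value:
  "(\<lambda>k. of_int (scaled_trunc x k) / 10 ^ k) \<longlonglongrightarrow> decimal_value x"
  unfolding decimal_value_def
  by (rule LIMSEQ_incseq_SUP[OF bdd_above_scaled_trunc incseq_scaled_trunc])

lemma of_rat_trunc: "real_of_rat (trunc k x) = of_int (scaled_trunc x k) / 10 ^ k"
  by (simp add: trunc_eq_scaled of_rat_divide of_rat_power)

lemma decimal_value_mono: "x \<le> y \<Longrightarrow> decimal_value x \<le> decimal_value y"
  by (rule LIMSEQ_le[OF scaled_trunc_tendsto_value scaled_trunc_tendsto_value])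
    (auto simp: decimal_le_iff divide_right_mono)

lemma tendsto_inverse_pow10: "(\<lambda>k. 1 / 10 ^ k :: real) \<longlonglongrightarrow> 0"
  using LIMSEQ_power_zero[of "1 / 10 :: real"] by (simp add: power_one_over)

text \<open>Rounding down at position \<open>k\<close> loses less than \<open>1 / 10 ^ k\<close>,
  hence nothing in the limit.\<close>

lemma decimal_value_eq_if_floor:
  assumes "\<And>k. scaled_trunc d k = \<lfloor>L * 10 ^ k\<rfloor>"
  shows "decimal_value d = L"
proof (rule antisym)
  show "decimal_value d \<le> L"
    by (rule LIMSEQ_le_const2[OF scaled_trunc_tendsto_value])
      (auto simp: assms field_simps)
  have "L \<le> of_int (scaled_trunc d k) / 10 ^ k + 1 / 10 ^ k" for k
  proof -
    have "L * 10 ^ k \<le> of_int (scaled_trunc d k) + 1" unfolding assms by linarith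
    then show ?thesis by (simp add: field_simps)
  qed
  then show "L \<le> decimal_value d"
    using LIMSEQ_le_const[OF tendsto_add[OF scaled_trunc_tendsto_value tendsto_inverse_pow10]]
    by auto
qed

text \<open>The floors of \<open>L * 10 ^ k\<close> are the truncations of the expansion of
  \<open>L\<close> without trailing nines. Truncations are integers below the scaled value, so no
  competitor exceeds these floors. This turns a bound on values into a bound on decimals.\<close>

lemma greatest_decimal_of_value:
  obtains d where "decimal_value d = L" "\<And>x. decimal_value x \<le> L \<Longrightarrow> x \<le> d"
proof -
  have "\<lfloor>L * 10 ^ Suc k\<rfloor> div 10 = \<lfloor>L * 10 ^ k\<rfloor>" for k
    using floor_divide_real_eq_div[of 10 "L * 10 ^ Suc k"] by simp
  then obtain d where d: "\<And>k. scaled_trunc d k = \<lfloor>L * 10 ^ k\<rfloor>"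
    by (rule decimal_from_scaled) blast
  show thesis
  proof
    show "decimal_value d = L" by (rule decimal_value_eq_if_floor[OF d])
    show "x \<le> d" if "decimal_value x \<le> L" for x
      unfolding decimal_le_iff d
    proof (intro allI)
      fix k
      have "of_int (scaled_trunc x k) \<le> decimal_value x * 10 ^ k"
        by (rule scaled_trunc_le_value)
      also have "\<dots> \<le> L * 10 ^ k" using that by simp
      finally show "scaled_trunc x k \<le> \<lfloor>L * 10 ^ k\<rfloor>" by (simp add: le_floor_iff)
    qed
  qed
qed

text \<open>From some place on, the scaled truncations of \<open>z\<close> exceed those of
  \<open>x\<close> by at least 1, while the comparison of values lets those of \<open>y\<close>
  exceed them by at most 1.\<close>

lemma le_if_less_value_le:
  assumes "x < z" "decimal_value y \<le> decimal_value x"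
  shows "y \<le> z"
proof -
  obtain k where k: "scaled_trunc x k < scaled_trunc z k"
    using assms(1) by (meson decimal_le_iff not_le)
  have later: "scaled_trunc y j \<le> scaled_trunc z j" if "k \<le> j" for j
  proof -
    have "of_int (scaled_trunc y j) \<le> decimal_value y * 10 ^ j" by (rule scaled_trunc_le_value)
    also have "\<dots> \<le> decimal_value x * 10 ^ j" using assms(2) by simp
    also have "\<dots> \<le> of_int (scaled_trunc x j) + 1" by (rule value_le_scaled_trunc)
    finally have "scaled_trunc y j \<le> scaled_trunc x j + 1" by linarith
    with scaled_trunc_less_later[OF k that] show ?thesis by linarith
  qed
  \<comment> \<open>Places before \<open>k\<close> inherit the inequality from place
    \<open>k\<close>, since dropping digits is monotone.\<close>
  show ?thesis
    unfolding decimal_le_iff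
    using later scaled_trunc_le_earlier[OF later[OF order_refl]] by (meson nat_le_linear)
qed

text \<open>Anything above the smaller of the two is already at least the larger one.\<close>

lemma no_gap_if_value_eq:
  assumes "decimal_value x = decimal_value y"
  shows "x \<sim> y"
  unfolding no_gap_def
  using le_if_less_value_le[of x _ y] le_if_less_value_le[of y _ x] assms
  by (metis leD order_refl)

lemma scaled_trunc_Psi: "scaled_trunc (Psi x) k = - 1 - scaled_trunc x k"
  by (induction k) (simp_all add: Psi.rep_eq)

text \<open>The offset \<open>- 1\<close> in the scaled truncations of \<open>Psi x\<close>
  contributes \<open>- 1 / 10 ^ k\<close>, which vanishes in the limit.\<close>

lemma decimal_value_Psi: "decimal_value (Psi x) = - decimal_value x"
proof -
  have "(\<lambda>k. - (1 / 10 ^ k) - of_int (scaled_trunc x k) / 10 ^ k) \<longlonglongrightarrow> - 0 - decimal_value x"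
    by (intro tendsto_intros tendsto_inverse_pow10 scaled_trunc_tendsto_value)
  then have "(\<lambda>k. of_int (scaled_trunc (Psi x) k) / 10 ^ k) \<longlonglongrightarrow> - decimal_value x"
    by (simp add: scaled_trunc_Psi diff_divide_distrib)
  then show ?thesis
    using scaled_trunc_tendsto_value LIMSEQ_unique by blast
qed

lemma decimal_value_Psi_funpow: "decimal_value ((Psi ^^ n) x) = (- 1) ^ n * decimal_value x"
  by (induction n) (simp_all add: decimal_value_Psi)

lemma decimal_value_absval: "decimal_value (absval x) = \<bar>decimal_value x\<bar>"
  using decimal_value_mono[of x "Psi x"] decimal_value_mono[of "Psi x" x]
  by (auto simp: absval_def max_def decimal_value_Psi)

lemma scaled_trunc_zero: "scaled_trunc zero_decimal k = 0"
  by (induction k) (simp_all add: zero_decimal.rep_eq)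

lemma decimal_value_zero: "decimal_value zero_decimal = 0"
  by (rule decimal_value_eq_if_floor) (simp add: scaled_trunc_zero)

lemma absval_nonneg: "zero_decimal \<le> absval x"
proof (cases "zero_decimal \<le> x")
  case False
  then have "x \<le> Psi zero_decimal" by (simp add: not_ge_zero_iff)
  \<comment> \<open>On scaled truncations \<open>Psi\<close> is the order-reversing involution
    sending \<open>a\<close> to \<open>- 1 - a\<close>.\<close>
  then have "zero_decimal \<le> Psi x"
    unfolding decimal_le_iff scaled_trunc_Psi by (smt (verit))
  then show ?thesis by (simp add: absval_def le_max_iff_disj)
qed (simp add: absval_def le_max_iff_disj)

text \<open>The sign bit and the sign of the value disagree only at \<open>Psi zero_decimal\<close>,
  where the value is 0 and both sides vanish.\<close>

lemma decimal_value_sgn_bit: "(- 1) ^ sgn_bit x * \<bar>decimal_value x\<bar> = decimal_value x"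
proof (cases "zero_decimal \<le> x")
  case True
  then show ?thesis
    using decimal_value_mono[OF True] by (simp add: sgn_bit_def decimal_value_zero)
next
  case False
  then show ?thesis
    using decimal_value_mono[of x zero_decimal] by (simp add: sgn_bit_def decimal_value_zero)
qed

text \<open>Long division keeps an exact balance: \<open>q * 10 ^ k\<close> is the scaled truncation
  times \<open>p\<close> plus a remainder in \<open>{0..<p}\<close>, so the truncation is an integer
  quotient.\<close>

lemma scaled_trunc_decimal_of_rat: "scaled_trunc (decimal_of_rat r) k = \<lfloor>real_of_rat r * 10 ^ k\<rfloor>"
proof -
  obtain q p where qp: "quotient_of r = (q, p)" by fastforce
  then have p: "p > 0" by (rule quotient_of_denom_pos)
  have r: "r = of_int q / of_int p" by (rule quotient_of_div[OF qp])
  have "q * 10 ^ k = scaled_trunc (decimal_of_rat r) k * p + snd (long_division q p k)"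
  proof (induction k)
    case 0
    then show ?case by (simp add: r digit_decimal_of_rat[OF p])
  next
    case (Suc k)
    have "q * 10 ^ Suc k = 10 * (scaled_trunc (decimal_of_rat r) k * p + snd (long_division q p k))"
      using Suc by simp
    then show ?case
      by (simp add: r digit_decimal_of_rat[OF p] Let_def algebra_simps)
  qed
  then have "scaled_trunc (decimal_of_rat r) k = (q * 10 ^ k) div p"
    using long_division_remainder[OF p, of q k] p by simp
  also have "\<dots> = \<lfloor>real_of_int (q * 10 ^ k) / real_of_int p\<rfloor>"
    by (rule floor_divide_of_int_eq[symmetric])
  finally show ?thesis by (simp add: r of_rat_divide)
qed

lemma decimal_value_of_rat: "decimal_value (decimal_of_rat r) = of_rat r"
  by (rule decimal_value_eq_if_floor[OF scaled_trunc_decimal_of_rat])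

lemma decimal_of_rat_mono: "r \<le> s \<Longrightarrow> decimal_of_rat r \<le> decimal_of_rat s"
  unfolding decimal_le_iff scaled_trunc_decimal_of_rat
  by (auto intro!: floor_mono simp: of_rat_less_eq)

text \<open>All tails of an increasing sequence have the same supremum, and the infimum of a tail is
  its first term.\<close>

lemma LIMIT_incseq:
  assumes "incseq X" "bdd_above (range X)"
  shows "LIMIT X = Sup (range X)"
proof -
  have bdd: "bdd_above {X k | k. k \<ge> n}" for n
    by (rule bdd_above_mono[OF assms(2)]) blast
  have tail: "Sup {X k | k. k \<ge> n} = Sup (range X)" for n
  proof (rule antisym)
    show "Sup {X k | k. k \<ge> n} \<le> Sup (range X)"
      by (rule cSup_subset_mono) (use assms in auto)
    show "Sup (range X) \<le> Sup {X k | k. k \<ge> n}"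
    proof (rule cSUP_least)
      fix k
      have "X k \<le> X (max n k)" using assms(1) by (simp add: incseq_def)
      also have "\<dots> \<le> Sup {X k | k. k \<ge> n}"
        by (rule cSup_upper[OF _ bdd]) auto
      finally show "X k \<le> Sup {X k | k. k \<ge> n}" .
    qed simp
  qed
  have head: "Inf {X k | k. k \<ge> n} = X n" for n
    by (rule cInf_eq_minimum) (use assms(1) in \<open>auto simp: incseq_def\<close>)
  have "upper_LIMIT X = Sup (range X)"
  proof -
    have "{Sup {X k | k. k \<ge> n} | n. n \<ge> 1} = {Sup (range X)}" by (auto simp: tail)
    then show ?thesis by (simp add: upper_LIMIT_def)
  qed
  \<comment> \<open>Only the infima for \<open>n \<ge> 1\<close> enter, so the tail from 1 has to be
    compared with the full range, which includes \<open>X 0\<close>.\<close>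
  moreover have "lower_LIMIT X = Sup (range X)"
    by (simp add: lower_LIMIT_def head tail[of 1, simplified])
  ultimately show ?thesis by (simp add: LIMIT_def)
qed

text \<open>The greatest decimal of value \<open>L\<close> bounds the sequence, so the supremum
  exists and has value at most \<open>L\<close>. It also dominates every term, and the values of the
  terms tend to \<open>L\<close>.\<close>

lemma decimal_value_LIMIT:
  assumes "incseq X" "(\<lambda>k. decimal_value (X k)) \<longlonglongrightarrow> L"
  shows "decimal_value (LIMIT X) = L"
proof -
  obtain d where d: "decimal_value d = L" "\<And>x. decimal_value x \<le> L \<Longrightarrow> x \<le> d"
    by (rule greatest_decimal_of_value) blast
  have "incseq (\<lambda>k. decimal_value (X k))"
    using assms(1) by (auto simp: incseq_def intro: decimal_value_mono)
  then have ub: "X k \<le> d" for k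
    using d(2) incseq_le assms(2) by blast
  then have bdd: "bdd_above (range X)" unfolding bdd_above_def by blast
  have "decimal_value (Sup (range X)) \<le> L"
    unfolding d(1)[symmetric] by (intro decimal_value_mono cSUP_least ub) simp
  moreover have "L \<le> decimal_value (Sup (range X))"
    by (rule LIMSEQ_le_const2[OF assms(2)]) (auto intro!: decimal_value_mono cSUP_upper bdd)
  ultimately show ?thesis by (simp add: LIMIT_incseq[OF assms(1) bdd])
qed

lemma incseq_trunc: "incseq (\<lambda>k. trunc k x)"
  using incseq_scaled_trunc[of x]
  by (simp add: incseq_def flip: of_rat_trunc) (simp add: of_rat_less_eq)

lemma trunc_nonneg: "zero_decimal \<le> x \<Longrightarrow> 0 \<le> trunc k x"
  by (simp add: decimal_le_iff scaled_trunc_zero trunc_eq_scaled)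

lemma decimal_value_mult: "decimal_value (x \<otimes> y) = decimal_value x * decimal_value y"
proof -
  let ?X = "\<lambda>k. decimal_of_rat (trunc k (absval x) * trunc k (absval y))"
  \<comment> \<open>Both factors increase and, thanks to the absolute values, are
    nonnegative.\<close>
  have "incseq ?X"
    unfolding incseq_def
    by (intro allI impI decimal_of_rat_mono mult_mono incseqD[OF incseq_trunc]
        trunc_nonneg absval_nonneg)
  moreover have "(\<lambda>k. decimal_value (?X k)) \<longlonglongrightarrow> \<bar>decimal_value x\<bar> * \<bar>decimal_value y\<bar>"
    unfolding decimal_value_of_rat of_rat_mult of_rat_trunc decimal_value_absval[symmetric]
    by (intro tendsto_mult scaled_trunc_tendsto_value)
  ultimately have "decimal_value (LIMIT ?X) = \<bar>decimal_value x\<bar> * \<bar>decimal_value y\<bar>"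
    by (rule decimal_value_LIMIT)
  \<comment> \<open>Each application of \<open>Psi\<close> negates the value, so the sign bits
    distribute over the two factors.\<close>
  then have "decimal_value (x \<otimes> y) =
      ((- 1) ^ sgn_bit x * \<bar>decimal_value x\<bar>) * ((- 1) ^ sgn_bit y * \<bar>decimal_value y\<bar>)"
    by (simp add: dec_mult_def decimal_value_Psi_funpow power_add)
  then show ?thesis by (simp only: decimal_value_sgn_bit)
qed

theorem theorem4p10:
  fixes x y z :: decimal
  shows "(x \<otimes> y) \<otimes> z \<sim> x \<otimes> (y \<otimes> z)"
  by (rule no_gap_if_value_eq) (simp add: decimal_value_mult mult.assoc)

end
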